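(* Every entry of any superfrieze is a Laurent polynomial in the entries of any diagonal.
   Context: Supercommutative ring: $\mathcal{R}=\mathcal{R}_{\bar0}\oplus\mathcal{R}_{\bar1}$ is $\mathbb{Z}/2$-graded; even elements are central, odd elements anticommute with each other and square to zero. Superfrieze of width $m$: an array consisting of even entries $f_{i,j}\in\mathcal{R}_{\bar0}$, for $i,j\in\mathbb{Z}$ with $-2\le j-i\le m+1$, and odd entries $\varphi_{i,j}\in\mathcal{R}_{\bar1}$, for $i,j$ both in $\mathbb{Z}$ or both in $\mathbb{Z}+\frac12$ with $-1\le j-i\le m+1$, such that: (Boundary) $f_{i,i-2}=0$, $f_{i,i-1}=1$, $f_{i,i+m}=1$, $f_{i,i+m+1}=0$ for all $i\in\mathbb{Z}$, and $\varphi_{i,i-1}=0=\varphi_{i,i+m+1}$ for all $i\in\frac12\mathbb{Z}$. (Frieze rule) for all $i,j\in\mathbb{Z}$ with $-1\le j-i\le m$, setting $A=f_{i,j}$, $B=f_{i+1,j}$, $C=f_{i,j+1}$, $D=f_{i+1,j+1}$, $\Xi=\varphi_{i+\frac12,j+\frac12}$, $\Psi=\varphi_{i+1,j+1}$, $\Phi=\varphi_{i,j+1}$, $\Sigma=\varphi_{i+\frac12,j+\frac32}$, one has $$AD-BC=1+\Sigma\Xi,\qquad A\Sigma-C\Xi=\Phi,\qquad B\Sigma-D\Xi=\Psi.$$ The integer $m$ is the number of even rows strictly between the two rows of $1$'s. Diagonals: the first index numbers the South-East diagonals and the second index numbers the North-East diagonals. For a fixed $j\in\mathbb{Z}$, the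 South-East diagonal consists of the entries $f_{j,i}$ and $\varphi_{j,i}$ ($i$ varying in $\mathbb{Z}$), and the North-East diagonal consists of the entries $f_{i,j}$ and $\varphi_{i+\frac12,j+\frac12}$ ($i$ varying in $\mathbb{Z}$).
   Formalization: The nontrivial even entries of the chosen diagonal are assumed invertible, and no nontrivial even entry of the superfrieze may be a zero divisor; without the latter the claim fails, e.g. for width 1 over Z[t]/(2t) with row ...,2,1,2,1+t,2,... *)

theory Defs
  imports "HOL-Library.Poly_Mapping"
begin

section \<open>Supercommutative rings\<close>

locale supercommutative_ring =
  fixes R\<^sub>0 R\<^sub>1 :: "'a::ring_1 set"
  assumes zero_even: "0 \<in> R\<^sub>0" and zero_odd: "0 \<in> R\<^sub>1"
    and diff_even: "\<lbrakk>a \<in> R\<^sub>0; b \<in> R\<^sub>0\<rbrakk> \<Longrightarrow> a - b \<in> R\<^sub>0"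
    and diff_odd: "\<lbrakk>a \<in> R\<^sub>1; b \<in> R\<^sub>1\<rbrakk> \<Longrightarrow> a - b \<in> R\<^sub>1"
    and decomp: "\<exists>a\<in>R\<^sub>0. \<exists>b\<in>R\<^sub>1. x = a + b"
    and disjoint: "R\<^sub>0 \<inter> R\<^sub>1 = {0}"
    and one_even: "1 \<in> R\<^sub>0"
    and mult_even_even: "\<lbrakk>a \<in> R\<^sub>0; b \<in> R\<^sub>0\<rbrakk> \<Longrightarrow> a * b \<in> R\<^sub>0"
    and mult_even_odd: "\<lbrakk>a \<in> R\<^sub>0; b \<in> R\<^sub>1\<rbrakk> \<Longrightarrow> a * b \<in> R\<^sub>1"
    and mult_odd_even: "\<lbrakk>a \<in> R\<^sub>1; b \<in> R\<^sub>0\<rbrakk> \<Longrightarrow> a * b \<in> R\<^sub>1"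
    and mult_odd_odd: "\<lbrakk>a \<in> R\<^sub>1; b \<in> R\<^sub>1\<rbrakk> \<Longrightarrow> a * b \<in> R\<^sub>0"
    and even_central: "a \<in> R\<^sub>0 \<Longrightarrow> a * x = x * a"
    and odd_anticommute: "\<lbrakk>a \<in> R\<^sub>1; b \<in> R\<^sub>1\<rbrakk> \<Longrightarrow> a * b = - (b * a)"
    and odd_square: "a \<in> R\<^sub>1 \<Longrightarrow> a * a = 0"

section \<open>Superfriezes\<close>

text \<open>
  The odd entries are indexed by pairs of integers or pairs of half-integers. Doubled indices are
  used: \<open>\<phi> p q\<close> stands for the odd entry with indices \<open>p/2\<close> and \<open>q/2\<close>, where
  \<open>p\<close> and \<open>q\<close> have the same parity. The values of \<open>f\<close> and \<open>\<phi>\<close> outside the index range of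
  the array are arbitrary and are not entries of the superfrieze.
\<close>

definition even_index :: "nat \<Rightarrow> int \<Rightarrow> int \<Rightarrow> bool" where
  "even_index m i j \<longleftrightarrow> -2 \<le> j - i \<and> j - i \<le> int m + 1"

definition odd_index :: "nat \<Rightarrow> int \<Rightarrow> int \<Rightarrow> bool" where
  "odd_index m p q \<longleftrightarrow> even (q - p) \<and> 2 * (-1) \<le> q - p \<and> q - p \<le> 2 * (int m + 1)"

locale superfrieze = supercommutative_ring R\<^sub>0 R\<^sub>1
  for R\<^sub>0 R\<^sub>1 :: "'a::ring_1 set" +
  fixes m :: nat
    and f :: "int \<Rightarrow> int \<Rightarrow> 'a"
    and \<phi> :: "int \<Rightarrow> int \<Rightarrow> 'a"
  assumes f_even: "even_index m i j \<Longrightarrow> f i j \<in> R\<^sub>0"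
    and phi_odd: "odd_index m p q \<Longrightarrow> \<phi> p q \<in> R\<^sub>1"
    and f_top_0: "f i (i - 2) = 0"
    and f_top_1: "f i (i - 1) = 1"
    and f_bottom_1: "f i (i + int m) = 1"
    and f_bottom_0: "f i (i + int m + 1) = 0"
    and phi_top: "\<phi> p (p - 2 * 1) = 0"
    and phi_bottom: "\<phi> p (p + 2 * (int m + 1)) = 0"
    and frieze_rule:
      "\<lbrakk>-1 \<le> j - i; j - i \<le> int m;
        A = f i j; B = f (i + 1) j; C = f i (j + 1); D = f (i + 1) (j + 1);
        \<Xi> = \<phi> (2 * i + 1) (2 * j + 1); \<Psi> = \<phi> (2 * (i + 1)) (2 * (j + 1));
        \<Phi> = \<phi> (2 * i) (2 * (j + 1)); \<Sigma> = \<phi> (2 * i + 1) (2 * j + 3)\<rbrakk>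
       \<Longrightarrow> A * D - B * C = 1 + \<Sigma> * \<Xi> \<and> A * \<Sigma> - C * \<Xi> = \<Phi> \<and> B * \<Sigma> - D * \<Xi> = \<Psi>"

text \<open>
  Without a genericity assumption a superfrieze need not be determined by a diagonal, even if all
  nontrivial even entries of this diagonal are invertible. For example, in \<open>\<int>[t]/(2t)\<close> (with
  zero odd part) the sequence \<open>\<dots>, 2, 1, 2, 1 + t, 2, 1, 2, \<dots>\<close> is the nontrivial row of a
  superfrieze of width \<open>1\<close>.
\<close>

definition zero_divisor :: "'a::ring_1 \<Rightarrow> bool" where
  "zero_divisor a \<longleftrightarrow> (\<exists>x. x \<noteq> 0 \<and> (a * x = 0 \<or> x * a = 0))"

definition generic :: "nat \<Rightarrow> (int \<Rightarrow> int \<Rightarrow> 'a::ring_1) \<Rightarrow> bool" where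
  "generic m f \<longleftrightarrow> (\<forall>i j. 0 \<le> j - i \<and> j - i \<le> int m - 1 \<longrightarrow> \<not> zero_divisor (f i j))"

section \<open>Diagonals\<close>

text \<open>
  The nontrivial entries of a diagonal, numbered from top to bottom: the \<open>m\<close> even entries
  \<open>k < m\<close> and the \<open>m + 1\<close> odd entries \<open>k \<le> m\<close>. The remaining entries are the \<open>0\<close> and \<open>1\<close>
  of the boundary.
\<close>

datatype diagonal = South_East int | North_East int

fun diag_even :: "(int \<Rightarrow> int \<Rightarrow> 'a) \<Rightarrow> diagonal \<Rightarrow> nat \<Rightarrow> 'a" where
  "diag_even f (South_East j) k = f j (j + int k)"
| "diag_even f (North_East j) k = f (j - int k) j"

fun diag_odd :: "(int \<Rightarrow> int \<Rightarrow> 'a) \<Rightarrow> diagonal \<Rightarrow> nat \<Rightarrow> 'a" where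
  "diag_odd \<phi> (South_East j) k = \<phi> (2 * j) (2 * (j + int k))"
| "diag_odd \<phi> (North_East j) k = \<phi> (2 * (j - int k) + 1) (2 * j + 1)"

section \<open>Laurent polynomials in even and odd variables\<close>

definition invertible :: "'a::ring_1 \<Rightarrow> bool" where
  "invertible a \<longleftrightarrow> (\<exists>b. a * b = 1 \<and> b * a = 1)"

definition int_power :: "'a::ring_1 \<Rightarrow> int \<Rightarrow> 'a" where
  "int_power a n =
    (if 0 \<le> n then a ^ nat n else (THE b. a * b = 1 \<and> b * a = 1) ^ nat (- n))"

text \<open>
  Integral Laurent polynomials in even variables \<open>x\<^sub>0, x\<^sub>1, \<dots>\<close> that are polynomials in odd
  variables \<open>\<theta>\<^sub>0, \<theta>\<^sub>1, \<dots>\<close>. The monomial \<open>(e, S)\<close> is the product of the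
  powers of \<open>x\<^sub>k\<close> with exponent \<open>e k\<close> and of the \<open>\<theta>\<^sub>k\<close> with \<open>k \<in> S\<close>, in increasing
  order of \<open>k\<close>.
\<close>

type_synonym super_laurent = "((nat \<Rightarrow>\<^sub>0 int) \<times> nat set) \<Rightarrow>\<^sub>0 int"

definition super_laurent_polys :: "nat \<Rightarrow> nat \<Rightarrow> super_laurent set" where
  "super_laurent_polys p q =
    {P. \<forall>(e, S) \<in> Poly_Mapping.keys P. Poly_Mapping.keys e \<subseteq> {..<p} \<and> S \<subseteq> {..<q}}"

definition eval_super_laurent ::
    "super_laurent \<Rightarrow> (nat \<Rightarrow> 'a::ring_1) \<Rightarrow> (nat \<Rightarrow> 'a) \<Rightarrow> 'a" where
  "eval_super_laurent P x \<theta> =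
    (\<Sum>(e, S) \<in> Poly_Mapping.keys P.
      of_int (Poly_Mapping.lookup P (e, S))
      * (\<Prod>k\<leftarrow>sorted_list_of_set (Poly_Mapping.keys e). int_power (x k) (Poly_Mapping.lookup e k))
      * (\<Prod>k\<leftarrow>sorted_list_of_set S. \<theta> k))"

end

theory Submission
  imports Defs
begin

text \<open>
  Write \<open>u i j\<close> and \<open>w i j\<close> for the odd entries with indices \<open>(i, j)\<close> and \<open>(i + 1/2, j + 1/2)\<close>. As for
  Coxeter friezes, the key is that the diagonals satisfy linear recurrences whose coefficients are
  the entries \<open>f i i\<close> and \<open>u i i\<close> of the first row. The frieze rules express every \<open>w i j\<close> by entries
  \<open>f\<close> and \<open>u\<close> in two ways, and comparing neighbouring squares shows that
  \<open>(u i (j + 1) - u i j) / f i j\<close> and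
  \<open>(f i (j + 1) + f i (j - 1) + u (j + 1) (j + 1) * u i j) / f i j\<close> do not depend on \<open>i\<close>. Genericity
  allows the cancellations, and \<open>i = j + 1\<close> gives the values \<open>u (j + 1) (j + 1)\<close> and
  \<open>f (j + 1) (j + 1)\<close> of the two ratios. These are the lemmas \<open>south_east_odd\<close> and \<open>south_east_even\<close>.
  The analogous recurrences in the North-East direction are, up to the sign of the odd entries, the
  South-East recurrences read backwards. As both start from the same boundary values, this proves
  the glide symmetry \<open>f i j = f (j - m - 1) (i - 2)\<close> and \<open>w i j = - u (j - m - 1) (i - 1)\<close>, and with it
  that the first row is periodic up to sign with period \<open>m + 3\<close>.

  By the glide symmetry, a North-East diagonal is a South-East diagonal read backwards, so let a
  South-East diagonal \<open>j\<close> be given. Solved for their coefficients, its recurrences give the first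
  row in the columns \<open>j, ..., j + m + 1\<close>, and the only divisions are by even entries of the diagonal. The
  column \<open>j + m + 2\<close> completes a period; by the glide symmetry its entries are, up to sign,
  \<open>f (j + 1) (j + m)\<close> and \<open>u (j + 1) (j + m + 1)\<close>, which the recurrences of the diagonal \<open>j + 1\<close> express
  polynomially by the columns already known. So the whole first row consists of Laurent polynomials,
  and every entry of the superfrieze is a polynomial in the first row.

  One polynomial has to serve for all superfriezes. Therefore entries are treated as functions on the
  set of all superfriezes in question, and \<open>laurent\<close> singles out those functions that are given by
  one super Laurent polynomial in the entries of the diagonal. They form a ring in which the even
  entries of the diagonal are units; this is all that the argument above uses.
\<close>


section \<open>Computation in a supercommutative ring\<close>

lemma second_difference:
  fixes p q :: "'a::ab_group_add"
  assumes "p - q = c - s" "p' - q' = c - s'" "s - s' = t - t'"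
  shows "q + p' + t' = p + q' + t"
proof -
  have *: "p = c - s + q" "p' = c - s' + q'" "t = s - s' + t'" using assms by (simp_all add: algebra_simps)
  show ?thesis unfolding * by (simp add: algebra_simps)
qed

context supercommutative_ring
begin

lemma even_left_commute: "a \<in> R\<^sub>0 \<Longrightarrow> x * (a * y) = a * (x * y)"
  by (metis even_central mult.assoc)

lemma odd_left_anticommute: "\<lbrakk>a \<in> R\<^sub>1; b \<in> R\<^sub>1\<rbrakk> \<Longrightarrow> a * (b * y) = - (b * (a * y))"
  by (metis odd_anticommute mult.assoc mult_minus_left)

lemma odd_left_square: "a \<in> R\<^sub>1 \<Longrightarrow> a * (a * y) = 0"
  by (metis odd_square mult.assoc mult_zero_left)

text \<open>
  The even recurrences come from subtracting the determinants of two neighbouring squares. The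
  determinants differ from \<open>1\<close> by a product of two odd entries; this is the change of such a product
  when both factors take a step of an odd recurrence with coefficient \<open>b\<close>.
\<close>

lemma odd_product_shift:
  assumes "x \<in> R\<^sub>0" "y \<in> R\<^sub>0" "s \<in> R\<^sub>1" "t \<in> R\<^sub>1" "b \<in> R\<^sub>1"
  shows "(s + x * b) * (t + y * b) - s * t = x * (b * t) - y * (b * s)"
proof -
  have 1: "b * (y * b) = 0"
    using assms by (simp add: even_left_commute[of y b b] odd_square)
  have 2: "s * (y * b) = - (y * (b * s))"
    using assms odd_anticommute[of s b] by (simp add: even_left_commute[of y s b])
  show ?thesis by (simp add: algebra_simps 1 2)
qed

text \<open>
  The last two frieze rules are a linear system for \<open>\<Sigma>\<close> and \<open>\<Xi>\<close> with determinant
  \<open>-(1 + \<Sigma> * \<Xi>)\<close>. Cramer's rule solves it without a division, because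
  \<open>(1 + \<Sigma> * \<Xi>) * \<Sigma> = \<Sigma>\<close> and \<open>(1 + \<Sigma> * \<Xi>) * \<Xi> = \<Xi>\<close>. The solution has the same shape as
  the original rules, with the roles of the two kinds of odd entries exchanged.
\<close>

lemma square_inverse:
  assumes ev: "A \<in> R\<^sub>0" "B \<in> R\<^sub>0" "C \<in> R\<^sub>0" "D \<in> R\<^sub>0" and od: "\<Sigma> \<in> R\<^sub>1" "\<Xi> \<in> R\<^sub>1"
    and det: "A * D - B * C = 1 + \<Sigma> * \<Xi>"
    and Phi: "A * \<Sigma> - C * \<Xi> = \<Phi>" and Psi: "B * \<Sigma> - D * \<Xi> = \<Psi>"
  shows "\<Sigma> = D * \<Phi> - C * \<Psi>" "\<Xi> = B * \<Phi> - A * \<Psi>" "A * D - B * C = 1 - \<Phi> * \<Psi>"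
proof -
  note [simp] = mult.assoc odd_square[OF od(1)] odd_square[OF od(2)]
    odd_left_square[OF od(1)] odd_left_square[OF od(2)]
  have DA: "D * A = A * D" "D * (A * z) = A * (D * z)" for z
    using ev by (simp_all add: even_central[of D A] even_left_commute[of A D])
  have CB: "C * B = B * C" "C * (B * z) = B * (C * z)" for z
    using ev by (simp_all add: even_central[of C B] even_left_commute[of B C])
  have DC: "D * (C * z) = C * (D * z)" for z
    using ev by (simp add: even_left_commute[of C D])
  have BA: "B * (A * z) = A * (B * z)" for z
    using ev by (simp add: even_left_commute[of A B])
  have X: "\<Xi> * \<Sigma> = - (\<Sigma> * \<Xi>)" using od(2,1) by (rule odd_anticommute[of \<Xi> \<Sigma>])
  have X': "\<Xi> * (\<Sigma> * z) = - (\<Sigma> * (\<Xi> * z))" for z using od(2,1) by (rule odd_left_anticommute[of \<Xi> \<Sigma>])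
  have "D * \<Phi> - C * \<Psi> = (A * D - B * C) * \<Sigma>"
    unfolding Phi[symmetric] Psi[symmetric] by (simp add: algebra_simps DA CB DC)
  also have "\<dots> = \<Sigma>" by (simp add: det X algebra_simps)
  finally show "\<Sigma> = D * \<Phi> - C * \<Psi>" by simp
  have "B * \<Phi> - A * \<Psi> = (A * D - B * C) * \<Xi>"
    unfolding Phi[symmetric] Psi[symmetric] by (simp add: algebra_simps BA)
  also have "\<dots> = \<Xi>" by (simp add: det X algebra_simps)
  finally show "\<Xi> = B * \<Phi> - A * \<Psi>" by simp
  have "\<Phi> * \<Psi> = - ((A * D - B * C) * (\<Sigma> * \<Xi>))"
    unfolding Phi[symmetric] Psi[symmetric]
    by (simp add: algebra_simps X DA CB even_central[OF ev(1), of \<Xi>, symmetric] even_central[OF ev(2), of \<Xi>, symmetric]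
      even_central[OF ev(3), of \<Xi>, symmetric] even_central[OF ev(4), of \<Xi>, symmetric]
      even_left_commute[OF ev(1), of \<Xi>] even_left_commute[OF ev(2), of \<Xi>]
      even_left_commute[OF ev(3), of \<Xi>] even_left_commute[OF ev(4), of \<Xi>]
      even_left_commute[OF ev(1), of \<Sigma>] even_left_commute[OF ev(2), of \<Sigma>]
      even_left_commute[OF ev(3), of \<Sigma>] even_left_commute[OF ev(4), of \<Sigma>])
  also have "\<dots> = - (\<Sigma> * \<Xi>)" by (simp add: det X X' algebra_simps)
  finally show "A * D - B * C = 1 - \<Phi> * \<Psi>" using det by simp
qed

end


section \<open>Linear recurrences and the glide symmetry\<close>

text \<open>
  Separating the two kinds of odd entries makes the indices of all recurrences integral:
  \<open>odd_half \<phi> i j\<close> is the odd entry with indices \<open>(i + 1/2, j + 1/2)\<close>.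
\<close>

definition odd_int :: "(int \<Rightarrow> int \<Rightarrow> 'a) \<Rightarrow> int \<Rightarrow> int \<Rightarrow> 'a" where
  "odd_int \<phi> i j = \<phi> (2 * i) (2 * j)"

definition odd_half :: "(int \<Rightarrow> int \<Rightarrow> 'a) \<Rightarrow> int \<Rightarrow> int \<Rightarrow> 'a" where
  "odd_half \<phi> i j = \<phi> (2 * i + 1) (2 * j + 1)"

locale generic_superfrieze = superfrieze +
  assumes generic: "generic m f"
begin

abbreviation u where "u \<equiv> odd_int \<phi>"
abbreviation w where "w \<equiv> odd_half \<phi>"

lemma f_boundary [simp]:
  "f (i + 2) i = 0" "f i (i - 2) = 0" "f i (i - 1) = 1" "f (i + 1) i = 1" "f i (i + int m) = 1" "f i (i + int m + 1) = 0"
  using f_top_0[of "i + 2"] f_top_0[of i] f_top_1[of "i + 1"] f_top_1[of i] f_bottom_1[of i] f_bottom_0[of i] by simp_all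

lemma u_boundary [simp]: "u i (i - 1) = 0" "u (i + 1) i = 0" "u i (i + int m + 1) = 0"
  using phi_top[of "2 * i"] phi_top[of "2 * (i + 1)"] phi_bottom[of "2 * i"] by (simp_all add: odd_int_def algebra_simps)

lemma w_boundary [simp]: "w i (i - 1) = 0" "w (i + 1) i = 0" "w i (i + int m + 1) = 0"
  using phi_top[of "2 * i + 1"] phi_top[of "2 * (i + 1) + 1"] phi_bottom[of "2 * i + 1"] by (simp_all add: odd_half_def algebra_simps)

lemma f_mem: "\<lbrakk>i \<le> j + 2; j - i \<le> int m + 1\<rbrakk> \<Longrightarrow> f i j \<in> R\<^sub>0"
  by (simp add: f_even even_index_def)

lemma u_mem: "\<lbrakk>i \<le> j + 1; j - i \<le> int m + 1\<rbrakk> \<Longrightarrow> u i j \<in> R\<^sub>1"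
  unfolding odd_int_def by (rule phi_odd) (simp add: odd_index_def algebra_simps)

lemma w_mem: "\<lbrakk>i \<le> j + 1; j - i \<le> int m + 1\<rbrakk> \<Longrightarrow> w i j \<in> R\<^sub>1"
  unfolding odd_half_def by (rule phi_odd) (simp add: odd_index_def algebra_simps)

lemma rules:
  assumes "i \<le> j + 1" "j - i \<le> int m"
  shows rule_det: "f i j * f (i + 1) (j + 1) - f (i + 1) j * f i (j + 1) = 1 + w i (j + 1) * w i j"
    and rule_left: "f i j * w i (j + 1) - f i (j + 1) * w i j = u i (j + 1)"
    and rule_right: "f (i + 1) j * w i (j + 1) - f (i + 1) (j + 1) * w i j = u (i + 1) (j + 1)"
  using frieze_rule[of j i, OF _ assms(2) refl refl refl refl refl refl refl refl]
  assms(1) by (simp_all add: odd_int_def odd_half_def algebra_simps)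

lemma dual_rules:
  assumes "i \<le> j + 1" "j - i \<le> int m"
  shows dual_rule_lower: "w i (j + 1) = f (i + 1) (j + 1) * u i (j + 1) - f i (j + 1) * u (i + 1) (j + 1)"
    and dual_rule_upper: "w i j = f (i + 1) j * u i (j + 1) - f i j * u (i + 1) (j + 1)"
    and dual_rule_det: "f i j * f (i + 1) (j + 1) - f (i + 1) j * f i (j + 1) = 1 - u i (j + 1) * u (i + 1) (j + 1)"
proof -
  have mem: "f i j \<in> R\<^sub>0" "f (i + 1) j \<in> R\<^sub>0" "f i (j + 1) \<in> R\<^sub>0" "f (i + 1) (j + 1) \<in> R\<^sub>0"
    "w i (j + 1) \<in> R\<^sub>1" "w i j \<in> R\<^sub>1"
    using assms by (auto intro!: f_mem w_mem)
  note * = square_inverse[OF mem rules[OF assms]]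
  show "w i (j + 1) = f (i + 1) (j + 1) * u i (j + 1) - f i (j + 1) * u (i + 1) (j + 1)" by (rule *(1))
  show "w i j = f (i + 1) j * u i (j + 1) - f i j * u (i + 1) (j + 1)" by (rule *(2))
  show "f i j * f (i + 1) (j + 1) - f (i + 1) j * f i (j + 1) = 1 - u i (j + 1) * u (i + 1) (j + 1)" by (rule *(3))
qed

lemma w_eq:
  assumes "i \<le> j" "j - i \<le> int m + 1"
  shows "w i j = f (i + 1) j * u i j - f i j * u (i + 1) j"
  using dual_rule_lower[of i "j - 1"] assms by simp

lemma f_cancel:
  assumes "i \<le> j + 1" "j - i \<le> int m" and eq: "f i j * x = f i j * y"
  shows "x = y"
proof -
  consider "j = i - 1" | "j = i + int m" | "0 \<le> j - i" "j - i \<le> int m - 1"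
    using assms by linarith
  then show ?thesis
  proof cases
    case 3
    then have "\<not> zero_divisor (f i j)" using generic by (auto simp: generic_def)
    moreover have "f i j * (x - y) = 0" using eq by (simp add: right_diff_distrib)
    ultimately show ?thesis unfolding zero_divisor_def by (metis eq_iff_diff_eq_0)
  qed (use eq in auto)
qed

text \<open>
  All recurrences below are obtained in the same way: the frieze rules say that two neighbouring
  quantities \<open>x\<close> and \<open>y\<close> are in the ratio of two neighbouring even entries \<open>s\<close> and \<open>f i j\<close>. The
  ratio \<open>b\<close> to the even entry is therefore constant along a diagonal, and it can be read off at the
  boundary row of ones.
\<close>

lemma cancel_ratio:
  assumes "i \<le> j + 1" "j - i \<le> int m" "s \<in> R\<^sub>0" and eq: "f i j * x = s * y" and y: "y = f i j * b"
  shows "x = s * b"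
  by (rule f_cancel[OF assms(1,2)]) (simp add: eq y even_left_commute[OF assms(3)])

lemma w_diag: "w i i = u i i"
  using rule_left[of i "i - 1"] by simp

text \<open>
  Both expressions of \<open>w (i - 1) j\<close>, from the square above it and from the square below it, must
  agree. This makes \<open>(u i (j + 1) - u i j) / f i j\<close> independent of \<open>i\<close>.
\<close>

lemma south_east_odd:
  assumes "i \<le> j + 1" "j - i \<le> int m"
  shows "u i (j + 1) = u i j + f i j * u (j + 1) (j + 1)"
  using assms
proof (induction i rule: int_le_induct)
  case base
  then show ?case by simp
next
  case (step i)
  let ?i = "i - 1"
  have r: "?i \<le> j + 1" "j - ?i \<le> int m" "?i \<le> j" "j - ?i \<le> int m + 1" using step by auto
  have "f i j * u ?i (j + 1) - f ?i j * u i (j + 1) = f i j * u ?i j - f ?i j * u i j"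
    using dual_rule_upper[OF r(1,2)] w_eq[OF r(3,4)] by simp
  then have eq: "f i j * (u ?i (j + 1) - u ?i j) = f ?i j * (u i (j + 1) - u i j)"
    by (simp add: algebra_simps)
  have y: "u i (j + 1) - u i j = f i j * u (j + 1) (j + 1)" using step by simp
  have s: "f ?i j \<in> R\<^sub>0" using r by (intro f_mem) auto
  have "u ?i (j + 1) - u ?i j = f ?i j * u (j + 1) (j + 1)"
    by (rule cancel_ratio[OF _ _ s eq y]) (use step in auto)
  then show ?case by (simp add: algebra_simps)
qed

text \<open>
  Here \<open>u i (j + 1)\<close> is the entry that two neighbouring squares share: it is on the right in the
  square \<open>(i - 1, j)\<close> and on the left in the square \<open>(i, j)\<close>.
\<close>

lemma north_east_odd:
  assumes "i \<le> j + 1" "j - i \<le> int m"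
  shows "w (i - 1) j = w i j + f i j * u (i - 1) (i - 1)"
proof -
  have "i - 1 \<le> j" using assms by simp
  then show ?thesis using assms
  proof (induction j rule: int_ge_induct)
    case base
    then show ?case using w_boundary(1)[of i] f_boundary(3)[of i] by (simp add: w_diag)
  next
    case (step j)
    have "f i j * w (i - 1) (j + 1) - f i (j + 1) * w (i - 1) j = f i j * w i (j + 1) - f i (j + 1) * w i j"
      using rule_right[of "i - 1" j] rule_left[of i j] step by simp
    then have eq: "f i j * (w (i - 1) (j + 1) - w i (j + 1)) = f i (j + 1) * (w (i - 1) j - w i j)"
      by (simp add: algebra_simps)
    have y: "w (i - 1) j - w i j = f i j * u (i - 1) (i - 1)" using step by simp
    have s: "f i (j + 1) \<in> R\<^sub>0" using step by (intro f_mem) auto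
    have "w (i - 1) (j + 1) - w i (j + 1) = f i (j + 1) * u (i - 1) (i - 1)"
      by (rule cancel_ratio[OF _ _ s eq y]) (use step in auto)
    then show ?case by (simp add: algebra_simps)
  qed
qed

text \<open>
  The super analogue of the three-term recurrence of Coxeter friezes, whose coefficients
  are the entries of the first row.
\<close>

lemma south_east_even:
  assumes "i \<le> j + 1" "j - i \<le> int m"
  shows "f i (j + 1) + f i (j - 1) + u (j + 1) (j + 1) * u i j = f i j * f (j + 1) (j + 1)"
  using assms
proof (induction i rule: int_le_induct)
  case base
  then show ?case using f_boundary(2)[of "j + 1"] by simp
next
  case (step i)
  let ?i = "i - 1" and ?b = "u (j + 1) (j + 1)"
  have mem: "f ?i j \<in> R\<^sub>0" "f i j \<in> R\<^sub>0" "u ?i j \<in> R\<^sub>1" "u i j \<in> R\<^sub>1" "?b \<in> R\<^sub>1"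
     "f i (j + 1) \<in> R\<^sub>0" "f i (j - 1) \<in> R\<^sub>0"
    using step by (auto intro!: f_mem u_mem)
  have "f ?i j * f i (j + 1) - f i j * f ?i (j + 1) = 1 - u ?i (j + 1) * u i (j + 1)"
    using dual_rule_det[of ?i j] step by simp
  moreover have "f i j * f ?i (j - 1) - f ?i j * f i (j - 1) = 1 - u ?i j * u i j"
    using dual_rule_det[of ?i "j - 1"] step mem by (simp add: even_central[of "f i j"] even_central[of "f i (j-1)"])
  moreover have "u ?i (j + 1) * u i (j + 1) - u ?i j * u i j = f ?i j * (?b * u i j) - f i j * (?b * u ?i j)"
    using south_east_odd[of ?i j] south_east_odd[of i j] step odd_product_shift[OF mem(1-5)] by simp
  ultimately have eq: "f i j * (f ?i (j + 1) + f ?i (j - 1) + ?b * u ?i j) = f ?i j * (f i (j + 1) + f i (j - 1) + ?b * u i j)"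
    unfolding distrib_left by (rule second_difference)
  have y: "f i (j + 1) + f i (j - 1) + ?b * u i j = f i j * f (j + 1) (j + 1)"
    using step by simp
  show ?case
    by (rule cancel_ratio[OF _ _ mem(1) eq y]) (use step in auto)
qed

lemma north_east_even:
  assumes "i \<le> j + 1" "j - i \<le> int m"
  shows "f (i - 1) j + f (i + 1) j - u (i - 1) (i - 1) * w i j = f i j * f (i - 1) (i - 1)"
proof -
  have "i - 1 \<le> j" using assms by simp
  then show ?thesis using assms
  proof (induction j rule: int_ge_induct)
    case base
    then show ?case using f_boundary(1)[of "i - 1"] by (simp add: add.commute)
  next
    case (step j)
    let ?b = "u (i - 1) (i - 1)"
    have mem: "f i (j + 1) \<in> R\<^sub>0" "f i j \<in> R\<^sub>0" "w i (j + 1) \<in> R\<^sub>1" "w i j \<in> R\<^sub>1" "?b \<in> R\<^sub>1"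
      using step by (auto intro!: f_mem u_mem w_mem)
    have "f i (j + 1) * f (i - 1) j - f i j * f (i - 1) (j + 1) = 1 - - (w (i - 1) (j + 1) * w (i - 1) j)"
      using rule_det[of "i - 1" j] step by (simp add: even_central[OF mem(1)])
    moreover have "f i j * f (i + 1) (j + 1) - f i (j + 1) * f (i + 1) j = 1 - - (w i (j + 1) * w i j)"
      using rule_det[of i j] step by (simp add: even_central[OF mem(1)])
    moreover have "w (i - 1) (j + 1) * w (i - 1) j - w i (j + 1) * w i j
        = f i (j + 1) * (?b * w i j) - f i j * (?b * w i (j + 1))"
      using north_east_odd[of i j] north_east_odd[of i "j + 1"] step odd_product_shift[OF mem(1-5)] by simp
    then have "- (w (i - 1) (j + 1) * w (i - 1) j) - - (w i (j + 1) * w i j)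
        = f i (j + 1) * - (?b * w i j) - f i j * - (?b * w i (j + 1))"
      by (simp add: algebra_simps)
    ultimately have eq: "f i j * (f (i - 1) (j + 1) + f (i + 1) (j + 1) - ?b * w i (j + 1)) = f i (j + 1) * (f (i - 1) j + f (i + 1) j - ?b * w i j)"
      unfolding diff_conv_add_uminus[of _ "?b * _"] distrib_left by (rule second_difference)
    have y: "f (i - 1) j + f (i + 1) j - ?b * w i j = f i j * f (i - 1) (i - 1)"
      using step by simp
    show ?case
      by (rule cancel_ratio[OF _ _ mem(1) eq y]) (use step in auto)
  qed
qed

text \<open>
  Going down the North-East diagonal \<open>j\<close> from the upper boundary and going up the South-East diagonal
  \<open>j - m - 1\<close> from the lower boundary, one meets the same recurrence with the same initial values,
  except for the sign of the odd entries. Two consecutive even entries are compared, because the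
  recurrence has second order.
\<close>

lemma glide:
  assumes "i \<le> j + 1" "j - i \<le> int m + 1"
  defines "k \<equiv> j - int m - 1"
  shows "f (i + 1) j = f k (i - 1) \<and> f i j = f k (i - 2) \<and> w i j = - u k (i - 1)"
  using assms(1,2)
proof (induction i rule: int_le_induct)
  case base
  have "f k j = 0" "f k (j - 1) = 1" "u k j = 0"
    using f_boundary(5,6)[of k] u_boundary(3)[of k] by (simp_all add: k_def)
  moreover have "f (j + 1 + 1) j = 0" using f_boundary(1)[of j] by (simp add: algebra_simps)
  ultimately show ?case by simp
next
  case (step i)
  let ?b = "u (i - 1) (i - 1)" and ?a = "f (i - 1) (i - 1)"
  have IH: "f (i + 1) j = f k (i - 1)" "f i j = f k (i - 2)" "w i j = - u k (i - 1)"
    using step by simp_all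
  have mem: "f k (i - 2) \<in> R\<^sub>0" "?b \<in> R\<^sub>1"
    using step by (auto intro!: f_mem u_mem simp: k_def)
  have E: "f (i - 1) j + f (i + 1) j - ?b * w i j = f i j * ?a"
    and O: "w (i - 1) j = w i j + f i j * ?b"
    using north_east_even[of i j] north_east_odd[of i j] step by simp_all
  have E': "f k (i - 1) + f k (i - 3) + ?b * u k (i - 2) = f k (i - 2) * ?a"
    and O': "u k (i - 1) = u k (i - 2) + f k (i - 2) * ?b"
    using south_east_even[of k "i - 2"] south_east_odd[of k "i - 2"] step by (simp_all add: k_def)
  \<comment> \<open>The odd product may be taken at either end of the step, since \<open>?b * ?b = 0\<close>.\<close>
  have "?b * u k (i - 1) = ?b * u k (i - 2)"
    using mem by (simp add: O' distrib_left even_left_commute odd_square)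
  then have "f (i - 1) j + (f k (i - 1) + ?b * u k (i - 2)) = f k (i - 3) + (f k (i - 1) + ?b * u k (i - 2))"
    using E E' unfolding IH by (simp add: add_ac)
  then have "f (i - 1) j = f k (i - 3)" by simp
  moreover have "w (i - 1) j = - u k (i - 2)"
    using O O' by (simp add: IH)
  ultimately show ?case using IH by simp
qed

lemma f_glide:
  assumes "i \<le> j + 2" "j - i \<le> int m + 1"
  shows "f i j = f (j - int m - 1) (i - 2)"
proof (cases "i \<le> j + 1")
  case True
  then show ?thesis using glide[of i j] assms by simp
next
  case False
  then have "i = j + 1 + 1" using assms by simp
  then show ?thesis using glide[of "j + 1" j] assms by (simp add: add_ac)
qed

lemma w_glide:
  assumes "i \<le> j + 1" "j - i \<le> int m + 1"
  shows "w i j = - u (j - int m - 1) (i - 1)"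
  using glide[of i j] assms by simp

text \<open>
  The glide reflection applied twice is the translation by \<open>m + 3\<close>.
\<close>

lemma f_diag_period: "f (i + (int m + 3)) (i + (int m + 3)) = f i i"
proof -
  have "f (i + (int m + 3)) (i + (int m + 3)) = f (i + 2) (i + int m + 1)"
    using f_glide[of "i + (int m + 3)" "i + (int m + 3)"] by (simp add: algebra_simps)
  also have "\<dots> = f i i"
    using f_glide[of "i + 2" "i + int m + 1"] by simp
  finally show ?thesis .
qed

text \<open>
  On odd entries the glide reflection exchanges \<open>u\<close> and \<open>w\<close>, and one is led back from \<open>u\<close> to \<open>w\<close> by
  the frieze rule at the lower boundary. Each of the three steps changes the sign.
\<close>

lemma u_diag_antiperiod: "u (i + (int m + 3)) (i + (int m + 3)) = - u i i"
proof -
  have 1: "u (i + (int m + 3)) (i + (int m + 3)) = - u (i + 2) (i + int m + 2)"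
    using w_glide[of "i + (int m + 3)" "i + (int m + 3)"] by (simp add: w_diag algebra_simps)
  have "- w (i + 1) (i + int m + 1) = u (i + 2) (i + int m + 2)"
    using rule_right[of "i + 1" "i + 1 + int m"] w_boundary(3)[of "i + 1"] f_boundary(5)[of "i + 2"]
    by (simp add: add_ac)
  then show ?thesis
    using 1 w_glide[of "i + 1" "i + int m + 1"] by simp
qed

end


section \<open>Products of central and of anticommuting elements\<close>

definition central :: "'a::ring_1 \<Rightarrow> bool" where
  "central a \<longleftrightarrow> (\<forall>z. a * z = z * a)"

lemma central_commute: "central a \<Longrightarrow> a * z = z * a"
  by (simp add: central_def)

lemma central_left_commute: "central a \<Longrightarrow> z * (a * y) = a * (z * y)"
  by (metis central_commute mult.assoc)

lemma central_1: "central 1"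
  by (simp add: central_def)

lemma central_of_int: "central (of_int n)"
  by (simp add: central_def mult_of_int_commute)

lemma central_mult: "\<lbrakk>central a; central b\<rbrakk> \<Longrightarrow> central (a * b)"
  unfolding central_def by (metis mult.assoc)

lemma central_power: "central a \<Longrightarrow> central (a ^ n)"
  by (induction n) (auto intro: central_1 central_mult)

lemma central_inverse:
  assumes "central a" "a * b = 1" "b * a = 1"
  shows "central b"
  unfolding central_def
proof
  fix z
  have "b * z = b * (z * a) * b" by (simp add: mult.assoc assms(2))
  also have "\<dots> = (b * a) * z * b" by (simp add: mult.assoc central_commute[OF assms(1)])
  finally show "b * z = z * b" by (simp add: assms(3))
qed

lemma central_prod_list: "(\<And>c. c \<in> set cs \<Longrightarrow> central c) \<Longrightarrow> central (prod_list cs)"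
  by (induction cs) (auto intro: central_1 central_mult)

lemma int_power_1 [simp]: "int_power a 0 = 1" "int_power a 1 = a"
  by (simp_all add: int_power_def)

lemma the_inverse:
  assumes "a * b = 1" "b * a = (1 :: 'a :: ring_1)"
  shows "(THE b. a * b = 1 \<and> b * a = 1) = b"
  using assms by (intro the_equality) (auto, metis mult.assoc mult_1_left mult_1_right)

lemma int_power_inverse:
  assumes "invertible a"
  shows "a * int_power a (- 1) = 1" "int_power a (- 1) * a = 1"
  using assms by (auto simp: int_power_def invertible_def the_inverse)

lemma central_int_power:
  assumes "invertible a" "central a"
  shows "central (int_power a n)"
proof -
  obtain b where b: "a * b = 1" "b * a = 1" using assms by (auto simp: invertible_def)
  then show ?thesis
    using assms(2) by (simp add: int_power_def the_inverse[OF b] central_power central_inverse[OF assms(2) b])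
qed

lemma int_power_step:
  assumes "invertible a"
  shows int_power_add1: "int_power a (n + 1) = a * int_power a n"
    and int_power_sub1: "int_power a (n - 1) = int_power a (- 1) * int_power a n"
proof -
  obtain b where b: "a * b = 1" "b * a = 1" using assms by (auto simp: invertible_def)
  have neg: "int_power a (- int k) = b ^ k" for k
    by (simp add: int_power_def the_inverse[OF b])
  have pos: "int_power a (int k) = a ^ k" for k
    by (simp add: int_power_def)
  have ab: "a * (b * z) = z" "b * (a * z) = z" for z
    by (simp_all flip: mult.assoc add: b)
  have up: "int_power a (n + 1) = a * int_power a n" for n
  proof (cases n rule: int_cases2)
    case (nonneg k)
    then show ?thesis using pos[of "Suc k"] pos[of k] by (simp add: add.commute)
  next
    case (nonpos k)
    show ?thesis
    proof (cases k)
      case 0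
      then show ?thesis using nonpos by simp
    next
      case (Suc l)
      then show ?thesis using nonpos neg[of l] neg[of "Suc l"] by (simp add: ab)
    qed
  qed
  show "int_power a (n + 1) = a * int_power a n" by (rule up)
  have "int_power a (- 1) = b" using neg[of 1] by simp
  then show "int_power a (n - 1) = int_power a (- 1) * int_power a n"
    using up[of "n - 1"] by (simp add: ab)
qed

lemma mult_prod_list_update:
  assumes "central c" "distinct ks" "k \<in> set ks"
  shows "c * prod_list (map g ks) = prod_list (map (g(k := c * g k)) ks)"
  using assms(2,3)
proof (induction ks)
  case (Cons l ks)
  show ?case
  proof (cases "l = k")
    case True
    then have *: "map (g(k := c * g k)) ks = map g ks" using Cons.prems by auto
    show ?thesis unfolding True list.map prod_list.Cons fun_upd_same * by (simp add: mult.assoc)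
  next
    case False
    then have "c * (g l * prod_list (map g ks)) = g l * (c * prod_list (map g ks))"
      by (simp add: central_left_commute[OF assms(1)])
    then show ?thesis using False Cons by simp
  qed
qed simp

lemma prod_list_map_filter:
  "(\<And>k. k \<in> set ks \<Longrightarrow> \<not> Q k \<Longrightarrow> g k = 1) \<Longrightarrow> prod_list (map g (filter Q ks)) = prod_list (map g ks)"
  for g :: "_ \<Rightarrow> 'a::monoid_mult"
  by (induction ks) auto

lemma sorted_list_of_subset: "K \<subseteq> {..<n} \<Longrightarrow> sorted_list_of_set K = filter (\<lambda>k. k \<in> K) [0..<n]"
proof -
  assume "K \<subseteq> {..<n}"
  then have "set (filter (\<lambda>k. k \<in> K) [0..<n]) = K" by auto
  then show ?thesis
    using sorted_list_of_set.idem_if_sorted_distinct[of "filter (\<lambda>k. k \<in> K) [0..<n]"]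
    by (simp add: sorted_wrt_filter)
qed

lemma odd_mult_eq_0:
  assumes anti: "\<And>i j. \<lbrakk>i \<in> set ks; j \<in> set ks\<rbrakk> \<Longrightarrow> t i * t j = - (t j * t i)"
    and square: "t k * t k = 0" and k: "k \<in> set ks"
  shows "t k * prod_list (map t ks) = (0 :: 'a::ring_1)"
proof -
  have "t k * prod_list (map t ls) = 0" if "k \<in> set ls" "set ls \<subseteq> set ks" for ls
    using that
  proof (induction ls)
    case (Cons l ls)
    show ?case
    proof (cases "l = k")
      case True
      then show ?thesis by (simp add: square flip: mult.assoc)
    next
      case False
      then have "t k * prod_list (map t ls) = 0" using Cons by auto
      moreover have "t k * t l = - (t l * t k)" by (rule anti) (use k Cons.prems in auto)
      then have "t k * (t l * prod_list (map t ls)) = - (t l * (t k * prod_list (map t ls)))"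
        by (simp flip: mult.assoc)
      ultimately show ?thesis by simp
    qed
  qed simp
  then show ?thesis using k by blast
qed

text \<open>
  The sign counts the odd variables that \<open>t k\<close> has to pass. It depends on the list only, not on the
  values \<open>t\<close>; so one polynomial serves for all values.
\<close>

lemma odd_mult_insort:
  assumes "\<And>i j. \<lbrakk>i \<in> insert k (set ks); j \<in> insert k (set ks)\<rbrakk> \<Longrightarrow> t i * t j = - (t j * t i)"
  shows "t k * prod_list (map t ks) =
    of_int ((- 1) ^ length (takeWhile (\<lambda>l. \<not> k \<le> l) ks)) * (prod_list (map t (insort k ks)) :: 'a::ring_1)"
  using assms
proof (induction ks)
  case (Cons l ks)
  show ?case
  proof (cases "k \<le> l")
    case False
    let ?s = "(- 1) ^ length (takeWhile (\<lambda>l. \<not> k \<le> l) ks) :: int"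
    have "t k * t l = - (t l * t k)" by (rule Cons.prems) auto
    then have "t k * (t l * prod_list (map t ks)) = - (t l * (t k * prod_list (map t ks)))"
      by (simp flip: mult.assoc)
    also have "t k * prod_list (map t ks) = of_int ?s * prod_list (map t (insort k ks))"
      by (rule Cons.IH, rule Cons.prems) auto
    also have "- (t l * (of_int ?s * prod_list (map t (insort k ks)))) =
        of_int (- ?s) * (t l * prod_list (map t (insort k ks)))"
      by (simp only: central_left_commute[OF central_of_int] of_int_minus mult_minus_left)
    finally show ?thesis using False by simp
  qed simp
qed simp


section \<open>The ring of super Laurent polynomials\<close>

definition monomial_value :: "(nat \<Rightarrow> 'a::ring_1) \<Rightarrow> (nat \<Rightarrow> 'a) \<Rightarrow> (nat \<Rightarrow>\<^sub>0 int) \<times> nat set \<Rightarrow> 'a" where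
  "monomial_value x \<theta> = (\<lambda>(e, S).
    (\<Prod>k\<leftarrow>sorted_list_of_set (Poly_Mapping.keys e). int_power (x k) (Poly_Mapping.lookup e k))
      * (\<Prod>k\<leftarrow>sorted_list_of_set S. \<theta> k))"

lemma eval_super_laurent_superset:
  assumes "finite N" "Poly_Mapping.keys P \<subseteq> N"
  shows "eval_super_laurent P x \<theta> = (\<Sum>\<nu>\<in>N. of_int (Poly_Mapping.lookup P \<nu>) * monomial_value x \<theta> \<nu>)"
proof -
  have "eval_super_laurent P x \<theta> =
      (\<Sum>\<nu>\<in>Poly_Mapping.keys P. of_int (Poly_Mapping.lookup P \<nu>) * monomial_value x \<theta> \<nu>)"
    unfolding eval_super_laurent_def monomial_value_def by (intro sum.cong) (auto simp: mult.assoc)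
  also have "\<dots> = (\<Sum>\<nu>\<in>N. of_int (Poly_Mapping.lookup P \<nu>) * monomial_value x \<theta> \<nu>)"
    using assms by (intro sum.mono_neutral_left) (auto simp: in_keys_iff)
  finally show ?thesis .
qed

text \<open>
  The statement to be proved asks for one polynomial that is correct in many superfriezes at once.
  Hence the elements of \<open>T\<close> are thought of as superfriezes, and quantities such as \<open>x k\<close>, \<open>\<theta> k\<close> and the
  entries as functions on \<open>T\<close>.
\<close>

locale super_variables =
  fixes T :: "'e set" and p q :: nat and x \<theta> :: "'e \<Rightarrow> nat \<Rightarrow> 'a::ring_1"
  assumes x_central: "\<lbrakk>e \<in> T; k < p\<rbrakk> \<Longrightarrow> central (x e k)"
    and x_invertible: "\<lbrakk>e \<in> T; k < p\<rbrakk> \<Longrightarrow> invertible (x e k)"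
    and \<theta>_anticommute: "\<lbrakk>e \<in> T; k < q; l < q\<rbrakk> \<Longrightarrow> \<theta> e k * \<theta> e l = - (\<theta> e l * \<theta> e k)"
    and \<theta>_square: "\<lbrakk>e \<in> T; k < q\<rbrakk> \<Longrightarrow> \<theta> e k * \<theta> e k = 0"
begin

lemma central_int_power_x: "\<lbrakk>e \<in> T; k < p\<rbrakk> \<Longrightarrow> central (int_power (x e k) n)"
  by (rule central_int_power[OF x_invertible x_central])

definition representable :: "('e \<Rightarrow> 'a) \<Rightarrow> bool" where
  "representable F \<longleftrightarrow> (\<exists>P\<in>super_laurent_polys p q. \<forall>e\<in>T. F e = eval_super_laurent P (x e) (\<theta> e))"

text \<open>
  The functions \<open>F\<close> such that multiplication by \<open>F\<close> preserves the values of super Laurent polynomials.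
  These are the same functions again, but closure under multiplication is immediate for them,
  and membership of a variable only needs its products with monomials. So no multiplication of
  polynomials in odd variables is required.
\<close>

definition laurent :: "('e \<Rightarrow> 'a) \<Rightarrow> bool" where
  "laurent F \<longleftrightarrow> (\<forall>G. representable G \<longrightarrow> representable (\<lambda>e. F e * G e))"

lemma representable_cong: "\<lbrakk>\<And>e. e \<in> T \<Longrightarrow> F e = G e; representable F\<rbrakk> \<Longrightarrow> representable G"
  by (simp add: representable_def)

lemma representable_monomial:
  assumes "Poly_Mapping.keys a \<subseteq> {..<p}" "S \<subseteq> {..<q}"
  shows "representable (\<lambda>e. of_int c * monomial_value (x e) (\<theta> e) (a, S))"
  unfolding representable_def
proof (intro bexI ballI)
  show "Poly_Mapping.single (a, S) c \<in> super_laurent_polys p q"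
    using assms by (auto simp: super_laurent_polys_def)
qed (subst eval_super_laurent_superset[of "{(a, S)}"], auto)

lemma representable_0: "representable (\<lambda>e. 0)"
  using representable_monomial[of 0 "{}" 0] by simp

lemma representable_1: "representable (\<lambda>e. 1)"
  using representable_monomial[of 0 "{}" 1] by (simp add: monomial_value_def)

lemma representable_add:
  assumes "representable F" "representable G"
  shows "representable (\<lambda>e. F e + G e)"
proof -
  obtain P Q where P: "P \<in> super_laurent_polys p q" "\<forall>e\<in>T. F e = eval_super_laurent P (x e) (\<theta> e)"
    and Q: "Q \<in> super_laurent_polys p q" "\<forall>e\<in>T. G e = eval_super_laurent Q (x e) (\<theta> e)"
    using assms by (auto simp: representable_def)
  let ?N = "Poly_Mapping.keys P \<union> Poly_Mapping.keys Q"
  have sub: "Poly_Mapping.keys (P + Q) \<subseteq> ?N" by (rule Poly_Mapping.keys_add)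
  show ?thesis
    unfolding representable_def
  proof (intro bexI ballI)
    show "P + Q \<in> super_laurent_polys p q"
      using P(1) Q(1) sub unfolding super_laurent_polys_def by blast
    fix e assume "e \<in> T"
    then show "F e + G e = eval_super_laurent (P + Q) (x e) (\<theta> e)"
      using P(2) Q(2) sub
      by (simp add: eval_super_laurent_superset[of ?N] lookup_add distrib_right sum.distrib)
  qed
qed

lemma representable_sum:
  "\<lbrakk>finite N; \<And>\<nu>. \<nu> \<in> N \<Longrightarrow> representable (F \<nu>)\<rbrakk> \<Longrightarrow> representable (\<lambda>e. \<Sum>\<nu>\<in>N. F \<nu> e)"
  by (induction N rule: finite_induct) (auto intro: representable_0 representable_add)

lemma laurentI:
  assumes "\<And>a S c. \<lbrakk>Poly_Mapping.keys a \<subseteq> {..<p}; S \<subseteq> {..<q}\<rbrakk> \<Longrightarrow>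
    representable (\<lambda>e. of_int c * (F e * monomial_value (x e) (\<theta> e) (a, S)))"
  shows "laurent F"
  unfolding laurent_def
proof (intro allI impI)
  fix G assume "representable G"
  then obtain P where P: "P \<in> super_laurent_polys p q" "\<forall>e\<in>T. G e = eval_super_laurent P (x e) (\<theta> e)"
    by (auto simp: representable_def)
  let ?g = "\<lambda>\<nu> e. of_int (Poly_Mapping.lookup P \<nu>) * (F e * monomial_value (x e) (\<theta> e) \<nu>)"
  have "representable (\<lambda>e. \<Sum>\<nu>\<in>Poly_Mapping.keys P. ?g \<nu> e)"
    using P(1) by (intro representable_sum) (auto simp: super_laurent_polys_def intro: assms)
  moreover have "(\<Sum>\<nu>\<in>Poly_Mapping.keys P. ?g \<nu> e) = F e * G e" if "e \<in> T" for e
    using that P(2) by (simp add: eval_super_laurent_superset[of "Poly_Mapping.keys P"] sum_distrib_left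
      central_left_commute[OF central_of_int])
  ultimately show "representable (\<lambda>e. F e * G e)" by (rule representable_cong[rotated])
qed

lemma representable_if_laurent:
  assumes "laurent F" shows "representable F"
proof -
  have "representable (\<lambda>e. F e * 1)"
    using assms representable_1 unfolding laurent_def by blast
  then show ?thesis by simp
qed

lemma laurent_cong:
  assumes "laurent F" "\<forall>e\<in>T. F e = G e"
  shows "laurent G"
  unfolding laurent_def
proof (intro allI impI)
  fix H assume "representable H"
  then have "representable (\<lambda>e. F e * H e)" using assms(1) by (simp add: laurent_def)
  then show "representable (\<lambda>e. G e * H e)" by (rule representable_cong[rotated]) (simp add: assms(2))
qed

lemma laurent_0: "laurent (\<lambda>e. 0)"
  by (simp add: laurent_def representable_0)

lemma laurent_1: "laurent (\<lambda>e. 1)"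
  by (simp add: laurent_def)

lemma laurent_add: "\<lbrakk>laurent F; laurent G\<rbrakk> \<Longrightarrow> laurent (\<lambda>e. F e + G e)"
  by (simp add: laurent_def distrib_right representable_add)

lemma laurent_mult: "\<lbrakk>laurent F; laurent G\<rbrakk> \<Longrightarrow> laurent (\<lambda>e. F e * G e)"
  by (simp add: laurent_def mult.assoc)

lemma laurent_uminus:
  assumes "laurent F" shows "laurent (\<lambda>e. - F e)"
proof -
  have "laurent (\<lambda>e. - 1)"
    by (rule laurentI) (use representable_monomial[of _ _ "- c" for c] in simp)
  from laurent_mult[OF this assms] show ?thesis by simp
qed

lemma laurent_diff: "\<lbrakk>laurent F; laurent G\<rbrakk> \<Longrightarrow> laurent (\<lambda>e. F e - G e)"
  using laurent_add[of F "\<lambda>e. - G e"] laurent_uminus[of G] by simp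

lemma even_part_of_monomial_value:
  assumes "Poly_Mapping.keys a \<subseteq> {..<p}"
  shows "(\<Prod>k\<leftarrow>sorted_list_of_set (Poly_Mapping.keys a). int_power (x e k) (Poly_Mapping.lookup a k)) =
    (\<Prod>k\<leftarrow>[0..<p]. int_power (x e k) (Poly_Mapping.lookup a k))"
  unfolding sorted_list_of_subset[OF assms]
  by (rule prod_list_map_filter) (simp add: in_keys_iff)

lemma laurent_even_variable_power:
  assumes k: "k < p" and s: "s = 1 \<or> s = - 1"
  shows "laurent (\<lambda>e. int_power (x e k) s)"
proof (rule laurentI)
  fix a :: "nat \<Rightarrow>\<^sub>0 int" and S and c :: int
  assume a: "Poly_Mapping.keys a \<subseteq> {..<p}" and S: "S \<subseteq> {..<q}"
  let ?b = "a + Poly_Mapping.single k s"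
  have b: "Poly_Mapping.keys ?b \<subseteq> {..<p}"
    using a k Poly_Mapping.keys_add[of a "Poly_Mapping.single k s"] by (auto split: if_splits)
  have "int_power (x e k) s * monomial_value (x e) (\<theta> e) (a, S) = monomial_value (x e) (\<theta> e) (?b, S)"
    if e: "e \<in> T" for e
  proof -
    let ?g = "\<lambda>k. int_power (x e k) (Poly_Mapping.lookup a k)"
    have "(\<Prod>k\<leftarrow>[0..<p]. int_power (x e k) (Poly_Mapping.lookup ?b k)) =
        prod_list (map (?g(k := int_power (x e k) s * ?g k)) [0..<p])"
      using s int_power_step[OF x_invertible[OF e k]]
      by (intro arg_cong[of _ _ prod_list] map_cong) (auto simp: lookup_add lookup_single when_def)
    also have "\<dots> = int_power (x e k) s * prod_list (map ?g [0..<p])"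
      using k e by (intro mult_prod_list_update[symmetric]) (simp_all add: central_int_power_x)
    finally show ?thesis
      unfolding monomial_value_def by (simp add: even_part_of_monomial_value[OF a] even_part_of_monomial_value[OF b] mult.assoc)
  qed
  then show "representable (\<lambda>e. of_int c * (int_power (x e k) s * monomial_value (x e) (\<theta> e) (a, S)))"
    by (intro representable_cong[OF _ representable_monomial[OF b S, of c]]) simp
qed

lemma laurent_even_variable: "k < p \<Longrightarrow> laurent (\<lambda>e. x e k)"
  using laurent_even_variable_power[of k 1] by simp

lemma laurent_odd_variable:
  assumes k: "k < q"
  shows "laurent (\<lambda>e. \<theta> e k)"
proof (rule laurentI)
  fix a :: "nat \<Rightarrow>\<^sub>0 int" and S and c :: int
  assume a: "Poly_Mapping.keys a \<subseteq> {..<p}" and S: "S \<subseteq> {..<q}"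
  have fin: "finite S" using S by (rule finite_subset) simp
  define d where "d = (if k \<in> S then 0 else (- 1) ^ length (takeWhile (\<lambda>l. \<not> k \<le> l) (sorted_list_of_set S)) :: int)"
  have "\<theta> e k * monomial_value (x e) (\<theta> e) (a, S) = of_int d * monomial_value (x e) (\<theta> e) (a, insert k S)"
    if e: "e \<in> T" for e
  proof -
    let ?X = "(\<Prod>k\<leftarrow>[0..<p]. int_power (x e k) (Poly_Mapping.lookup a k))"
    have X: "central ?X"
      using e by (intro central_prod_list) (auto simp: central_int_power_x)
    have "\<theta> e k * prod_list (map (\<theta> e) (sorted_list_of_set S)) =
        of_int d * prod_list (map (\<theta> e) (sorted_list_of_set (insert k S)))"
    proof (cases "k \<in> S")
      case True
      have "\<theta> e k * prod_list (map (\<theta> e) (sorted_list_of_set S)) = 0"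
        by (rule odd_mult_eq_0[OF \<theta>_anticommute \<theta>_square]) (use True S fin k e in auto)
      then show ?thesis using True by (simp add: d_def)
    next
      case False
      show ?thesis
        unfolding d_def if_not_P[OF False] sorted_list_of_set.sorted_key_list_of_set_insert[OF fin False]
        by (rule odd_mult_insort[OF \<theta>_anticommute]) (use S fin k e in auto)
    qed
    then show ?thesis
      unfolding monomial_value_def by (simp add: even_part_of_monomial_value[OF a] central_left_commute[OF X])
  qed
  moreover have "representable (\<lambda>e. of_int (c * d) * monomial_value (x e) (\<theta> e) (a, insert k S))"
    using a S k by (intro representable_monomial) auto
  ultimately show "representable (\<lambda>e. of_int c * (\<theta> e k * monomial_value (x e) (\<theta> e) (a, S)))"
    by (elim representable_cong[rotated]) (simp add: mult.assoc)
qed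

text \<open>
  The recurrences determine their coefficients only after a division. It is harmless if the divisor
  is of this kind.
\<close>

definition laurent_unit :: "('e \<Rightarrow> 'a) \<Rightarrow> bool" where
  "laurent_unit D \<longleftrightarrow> laurent D \<and> (\<exists>I. laurent I \<and> (\<forall>e\<in>T. I e * D e = 1))"

lemma laurent_unit_1: "laurent_unit (\<lambda>e. 1)"
  unfolding laurent_unit_def by (intro conjI exI[of _ "\<lambda>e. 1"]) (simp_all add: laurent_1)

lemma laurent_unit_even_variable: "k < p \<Longrightarrow> laurent_unit (\<lambda>e. x e k)"
  unfolding laurent_unit_def
  by (intro conjI exI[of _ "\<lambda>e. int_power (x e k) (- 1)"])
    (simp_all add: laurent_even_variable laurent_even_variable_power int_power_inverse(2) x_invertible)

lemma laurent_unit_cong: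
  assumes "laurent_unit F" "\<forall>e\<in>T. F e = G e"
  shows "laurent_unit G"
  using assms laurent_cong[OF _ assms(2)] unfolding laurent_unit_def by simp

lemma laurent_divide:
  assumes "laurent_unit D" "laurent H" "\<forall>e\<in>T. H e = D e * G e"
  shows "laurent G"
proof -
  obtain I where I: "laurent I" "\<forall>e\<in>T. I e * D e = 1"
    using assms(1) by (auto simp: laurent_unit_def)
  show ?thesis
    by (rule laurent_cong[OF laurent_mult[OF I(1) assms(2)]])
      (use I(2) assms(3) in \<open>simp flip: mult.assoc\<close>)
qed

end


section \<open>Laurent polynomials from one diagonal\<close>

locale superfrieze_family = super_variables T p q x \<theta>
  for T :: "'e set" and p q :: nat and x \<theta> :: "'e \<Rightarrow> nat \<Rightarrow> 'a::ring_1" +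
  fixes m :: nat and F \<Phi> :: "'e \<Rightarrow> int \<Rightarrow> int \<Rightarrow> 'a"
  assumes family: "e \<in> T \<Longrightarrow> \<exists>R\<^sub>0 R\<^sub>1. generic_superfrieze R\<^sub>0 R\<^sub>1 m (F e) (\<Phi> e)"
begin

lemma family_ball:
  assumes "\<And>R\<^sub>0 R\<^sub>1 e. generic_superfrieze R\<^sub>0 R\<^sub>1 m (F e) (\<Phi> e) \<Longrightarrow> Q e"
  shows "\<forall>e\<in>T. Q e"
  using family assms by blast

abbreviation U where "U e \<equiv> odd_int (\<Phi> e)"
abbreviation W where "W e \<equiv> odd_half (\<Phi> e)"

text \<open>
  Starting from \<open>0, 1\<close> and \<open>0\<close> at the upper boundary, the South-East recurrences express the entries
  of a diagonal as polynomials in the first row. Two consecutive even entries are needed for a step.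
\<close>

lemma laurent_south_east:
  assumes row: "\<And>k. \<lbrakk>i \<le> k; k \<le> h\<rbrakk> \<Longrightarrow> laurent (\<lambda>e. F e k k) \<and> laurent (\<lambda>e. U e k k)"
    and "i - 1 \<le> l" "l \<le> h" "l - i \<le> int m + 1"
  shows "laurent (\<lambda>e. F e i (l - 1)) \<and> laurent (\<lambda>e. F e i l) \<and> laurent (\<lambda>e. U e i l)"
  using assms(2-4)
proof (induction l rule: int_ge_induct)
  case base
  have "\<forall>e\<in>T. 0 = F e i (i - 2)"
    by (rule family_ball, drule generic_superfrieze.f_boundary(2)[where i = i], simp)
  moreover have "\<forall>e\<in>T. 1 = F e i (i - 1)"
    by (rule family_ball, drule generic_superfrieze.f_boundary(3)[where i = i], simp)
  moreover have "\<forall>e\<in>T. 0 = U e i (i - 1)"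
    by (rule family_ball, drule generic_superfrieze.u_boundary(1)[where i = i], simp)
  ultimately show ?case
    using laurent_cong[OF laurent_0] laurent_cong[OF laurent_1] by simp
next
  case (step l)
  have IH: "laurent (\<lambda>e. F e i (l - 1))" "laurent (\<lambda>e. F e i l)" "laurent (\<lambda>e. U e i l)"
    using step by simp_all
  have ab: "laurent (\<lambda>e. F e (l + 1) (l + 1))" "laurent (\<lambda>e. U e (l + 1) (l + 1))"
    using row[of "l + 1"] step by simp_all
  have r: "i \<le> l + 1" "l - i \<le> int m" using step by simp_all
  have "\<forall>e\<in>T. F e i l * F e (l + 1) (l + 1) - F e i (l - 1) - U e (l + 1) (l + 1) * U e i l = F e i (l + 1)"
    by (rule family_ball, drule generic_superfrieze.south_east_even[OF _ r], simp add: algebra_simps)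
  then have "laurent (\<lambda>e. F e i (l + 1))"
    by (rule laurent_cong[rotated]) (intro laurent_diff laurent_mult ab IH)
  moreover have "\<forall>e\<in>T. U e i l + F e i l * U e (l + 1) (l + 1) = U e i (l + 1)"
    by (rule family_ball, drule generic_superfrieze.south_east_odd[OF _ r], simp)
  then have "laurent (\<lambda>e. U e i (l + 1))"
    by (rule laurent_cong[rotated]) (intro laurent_add laurent_mult ab IH)
  ultimately show ?case using IH by simp
qed

lemma laurent_first_row_periodic:
  fixes k c :: int
  shows "laurent (\<lambda>e. F e k k) \<and> laurent (\<lambda>e. U e k k) \<longleftrightarrow>
    laurent (\<lambda>e. F e (k + c * (int m + 3)) (k + c * (int m + 3))) \<and>
    laurent (\<lambda>e. U e (k + c * (int m + 3)) (k + c * (int m + 3)))"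
proof -
  define Q where "Q k \<longleftrightarrow> laurent (\<lambda>e. F e k k) \<and> laurent (\<lambda>e. U e k k)" for k
  have Q: "Q (k + (int m + 3)) \<longleftrightarrow> Q k" for k
  proof -
    let ?k = "k + (int m + 3)"
    have F: "\<forall>e\<in>T. F e ?k ?k = F e k k"
      by (rule family_ball, drule generic_superfrieze.f_diag_period[where i = k], simp)
    have U: "\<forall>e\<in>T. U e ?k ?k = - U e k k"
      by (rule family_ball, drule generic_superfrieze.u_diag_antiperiod[where i = k], simp)
    have "laurent (\<lambda>e. F e ?k ?k) \<longleftrightarrow> laurent (\<lambda>e. F e k k)"
      using laurent_cong[OF _ F] laurent_cong[of "\<lambda>e. F e k k" "\<lambda>e. F e ?k ?k"] F by auto
    moreover have "laurent (\<lambda>e. U e ?k ?k) \<longleftrightarrow> laurent (\<lambda>e. - U e k k)"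
      using laurent_cong[OF _ U] laurent_cong[of "\<lambda>e. - U e k k" "\<lambda>e. U e ?k ?k"] U by auto
    moreover have "laurent (\<lambda>e. - U e k k) \<longleftrightarrow> laurent (\<lambda>e. U e k k)"
      using laurent_uminus[of "\<lambda>e. U e k k"] laurent_uminus[of "\<lambda>e. - U e k k"] by auto
    ultimately show ?thesis by (simp add: Q_def)
  qed
  have "Q k \<longleftrightarrow> Q (k + c * (int m + 3))"
  proof (induction c rule: int_induct[of _ 0])
    case (step1 c)
    then show ?case using Q[of "k + c * (int m + 3)"] by (simp add: algebra_simps)
  next
    case (step2 c)
    then show ?case using Q[of "k + (c - 1) * (int m + 3)"] by (simp add: algebra_simps)
  qed simp
  then show ?thesis by (simp add: Q_def)
qed

text \<open>
  The only divisions are by entries of the given diagonal: they are needed to find the first row,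
  and everything else is polynomial in the first row.
\<close>

lemma laurent_entries:
  assumes even: "\<And>l. \<lbrakk>j \<le> l; l < j + int m\<rbrakk> \<Longrightarrow> laurent_unit (\<lambda>e. F e j l)"
    and odd: "\<And>l. \<lbrakk>j \<le> l; l \<le> j + int m\<rbrakk> \<Longrightarrow> laurent (\<lambda>e. U e j l)"
  shows laurent_even_entry: "even_index m k l \<Longrightarrow> laurent (\<lambda>e. F e k l)"
    and laurent_odd_entry: "odd_index m s t \<Longrightarrow> laurent (\<lambda>e. \<Phi> e s t)"
proof -
  have unit: "laurent_unit (\<lambda>e. F e j l)" if "j - 1 \<le> l" "l \<le> j + int m" for l
  proof -
    consider "l = j - 1" | "j \<le> l" "l < j + int m" | "l = j + int m" using \<open>j - 1 \<le> l\<close> \<open>l \<le> j + int m\<close> by linarith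
    then show ?thesis
    proof cases
      case 2
      then show ?thesis by (rule even)
    next
      case 1
      have "\<forall>e\<in>T. 1 = F e j l"
        by (rule family_ball, drule generic_superfrieze.f_boundary(3)[where i = j], simp add: 1)
      with laurent_unit_1 show ?thesis by (rule laurent_unit_cong)
    next
      case 3
      have "\<forall>e\<in>T. 1 = F e j l"
        by (rule family_ball, drule generic_superfrieze.f_boundary(5)[where i = j], simp add: 3)
      with laurent_unit_1 show ?thesis by (rule laurent_unit_cong)
    qed
  qed
  have F: "laurent (\<lambda>e. F e j l)" if "j - 2 \<le> l" "l \<le> j + int m + 1" for l
  proof (cases "l = j - 2 \<or> l = j + int m + 1")
    case True
    have "\<forall>e\<in>T. F e j (j - 2) = 0 \<and> F e j (j + int m + 1) = 0"
      by (rule family_ball, frule generic_superfrieze.f_boundary(2)[where i = j],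
        drule generic_superfrieze.f_boundary(6)[where i = j], simp)
    then have "\<forall>e\<in>T. 0 = F e j l" using True by auto
    with laurent_0 show ?thesis by (rule laurent_cong)
  next
    case False
    then show ?thesis using unit[of l] that by (simp add: laurent_unit_def)
  qed
  have U: "laurent (\<lambda>e. U e j l)" if "j - 1 \<le> l" "l \<le> j + int m + 1" for l
  proof (cases "l = j - 1 \<or> l = j + int m + 1")
    case True
    have "\<forall>e\<in>T. U e j (j - 1) = 0 \<and> U e j (j + int m + 1) = 0"
      by (rule family_ball, frule generic_superfrieze.u_boundary(1)[where i = j],
        drule generic_superfrieze.u_boundary(3)[where i = j], simp)
    then have "\<forall>e\<in>T. 0 = U e j l" using True by auto
    with laurent_0 show ?thesis by (rule laurent_cong)
  next
    case False
    then show ?thesis using odd[of l] that by simp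
  qed
  \<comment> \<open>The recurrences along the given diagonal, solved for their coefficients.\<close>
  have row: "laurent (\<lambda>e. F e k k) \<and> laurent (\<lambda>e. U e k k)" if k: "j \<le> k" "k \<le> j + int m + 1" for k
  proof -
    have r: "j \<le> (k - 1) + 1" "(k - 1) - j \<le> int m" using k by simp_all
    have O: "\<forall>e\<in>T. U e j k - U e j (k - 1) = F e j (k - 1) * U e k k"
      by (rule family_ball, drule generic_superfrieze.south_east_odd[OF _ r], simp)
    have b: "laurent (\<lambda>e. U e k k)"
      by (rule laurent_divide[OF unit[of "k - 1"] laurent_diff[OF U U] O]) (use k in simp_all)
    have E: "\<forall>e\<in>T. F e j k + F e j (k - 2) + U e k k * U e j (k - 1) = F e j (k - 1) * F e k k"
      by (rule family_ball, drule generic_superfrieze.south_east_even[OF _ r], simp)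
    have "laurent (\<lambda>e. F e k k)"
      by (rule laurent_divide[OF unit[of "k - 1"] laurent_add[OF laurent_add[OF F F] laurent_mult[OF b U]] E])
        (use k in simp_all)
    with b show ?thesis by blast
  qed
  \<comment> \<open>This leaves one column of a full period, which the glide symmetry moves to the lower end of the
    diagonal \<open>j + 1\<close>; that part of the diagonal involves only the columns already found.\<close>
  have last: "laurent (\<lambda>e. F e k k) \<and> laurent (\<lambda>e. U e k k)" if k: "k = j + int m + 2" for k
  proof -
    have "\<forall>e\<in>T. F e (j + 1) (j + int m + 1 - 1) = F e k k"
      by (rule family_ball, drule generic_superfrieze.f_glide[where i = k and j = k]) (simp_all add: k algebra_simps)
    moreover have "\<forall>e\<in>T. - U e (j + 1) (j + int m + 1) = U e k k"
      by (rule family_ball, frule generic_superfrieze.w_diag[where i = k],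
        drule generic_superfrieze.w_glide[where i = k and j = k]) (simp_all add: k algebra_simps)
    moreover have "laurent (\<lambda>e. F e (j + 1) (j + int m + 1 - 1))" "laurent (\<lambda>e. U e (j + 1) (j + int m + 1))"
      using laurent_south_east[of "j + 1" "j + int m + 1" "j + int m + 1"] row by simp_all
    ultimately show ?thesis
      by (blast intro: laurent_cong laurent_uminus)
  qed
  have all: "laurent (\<lambda>e. F e k k) \<and> laurent (\<lambda>e. U e k k)" for k
  proof -
    let ?n = "int m + 3"
    define r where "r = j + (k - j) mod ?n"
    have "0 \<le> (k - j) mod ?n" "(k - j) mod ?n < ?n" by simp_all
    then have "j \<le> r" "r \<le> j + int m + 2" unfolding r_def by linarith+
    then have "laurent (\<lambda>e. F e r r) \<and> laurent (\<lambda>e. U e r r)"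
      using row[of r] last[of r] by linarith
    moreover have "r + (k - j) div ?n * ?n = k"
      using mod_div_mult_eq[of "k - j" ?n] by (simp add: r_def)
    ultimately show ?thesis
      using laurent_first_row_periodic[of r "(k - j) div ?n"] by simp
  qed
  have entry: "laurent (\<lambda>e. F e i l)" "laurent (\<lambda>e. U e i l)" if "i - 1 \<le> l" "l - i \<le> int m + 1" for i l
    using laurent_south_east[of i l l] all that by simp_all
  have F_entry: "laurent (\<lambda>e. F e i l)" if "i - 2 \<le> l" "l - i \<le> int m + 1" for i l
    using laurent_south_east[of i "l + 1" "l + 1"] entry[of i l] all that by (cases "l = i - 2") simp_all
  have W_entry: "laurent (\<lambda>e. W e i l)" if il: "i - 1 \<le> l" "l - i \<le> int m + 1" for i l
  proof (cases "i \<le> l")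
    case True
    have eq: "\<forall>e\<in>T. F e (i + 1) l * U e i l - F e i l * U e (i + 1) l = W e i l"
      by (rule family_ball, drule generic_superfrieze.w_eq[OF _ True il(2)], simp)
    show ?thesis
      by (rule laurent_cong[OF _ eq], intro laurent_diff laurent_mult F_entry entry) (use True il in simp_all)
  next
    case False
    then have l: "l = i - 1" using il by simp
    have "\<forall>e\<in>T. 0 = W e i l"
      by (rule family_ball, drule generic_superfrieze.w_boundary(1)[where i = i], simp add: l)
    with laurent_0 show ?thesis by (rule laurent_cong)
  qed
  show "laurent (\<lambda>e. F e k l)" if "even_index m k l"
    using that F_entry[of k l] by (simp add: even_index_def)
  show "laurent (\<lambda>e. \<Phi> e s t)" if "odd_index m s t"
  proof (cases "even s")
    case True
    with that obtain i l where il: "s = 2 * i" "t = 2 * l" by (auto simp: odd_index_def elim!: evenE)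
    have "laurent (\<lambda>e. U e i l)"
      using that il by (intro entry) (simp_all add: odd_index_def)
    then show ?thesis by (simp add: il odd_int_def)
  next
    case False
    with that have "odd t" by (simp add: odd_index_def)
    with False obtain i l where il: "s = 2 * i + 1" "t = 2 * l + 1" by (auto elim!: oddE)
    have "laurent (\<lambda>e. W e i l)"
      using that il by (intro W_entry) (simp_all add: odd_index_def)
    then show ?thesis by (simp add: il odd_half_def)
  qed
qed

end

theorem proposition2p9p1:
  fixes m :: nat and d :: diagonal
  shows "(\<forall>k l. even_index m k l \<longrightarrow>
           (\<exists>P \<in> super_laurent_polys m (m + 1).
             \<forall>(R\<^sub>0 :: 'a::ring_1 set) R\<^sub>1 f \<phi>.
               superfrieze R\<^sub>0 R\<^sub>1 m f \<phi> \<longrightarrow> generic m f \<longrightarrow>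
               (\<forall>n<m. invertible (diag_even f d n)) \<longrightarrow>
               f k l = eval_super_laurent P (diag_even f d) (diag_odd \<phi> d)))
       \<and> (\<forall>p q. odd_index m p q \<longrightarrow>
           (\<exists>P \<in> super_laurent_polys m (m + 1).
             \<forall>(R\<^sub>0 :: 'a::ring_1 set) R\<^sub>1 f \<phi>.
               superfrieze R\<^sub>0 R\<^sub>1 m f \<phi> \<longrightarrow> generic m f \<longrightarrow>
               (\<forall>n<m. invertible (diag_even f d n)) \<longrightarrow>
               \<phi> p q = eval_super_laurent P (diag_even f d) (diag_odd \<phi> d)))"
proof -
  define T :: "((int \<Rightarrow> int \<Rightarrow> 'a) \<times> (int \<Rightarrow> int \<Rightarrow> 'a)) set" where
    "T = {(f, \<phi>). (\<exists>R\<^sub>0 R\<^sub>1. generic_superfrieze R\<^sub>0 R\<^sub>1 m f \<phi>) \<and> (\<forall>n<m. invertible (diag_even f d n))}"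
  define x where "x e = diag_even (fst e) d" for e :: "(int \<Rightarrow> int \<Rightarrow> 'a) \<times> (int \<Rightarrow> int \<Rightarrow> 'a)"
  define \<theta> where "\<theta> e = diag_odd (snd e) d" for e :: "(int \<Rightarrow> int \<Rightarrow> 'a) \<times> (int \<Rightarrow> int \<Rightarrow> 'a)"
  have T: "\<exists>R\<^sub>0 R\<^sub>1. generic_superfrieze R\<^sub>0 R\<^sub>1 m (fst e) (snd e)" if "e \<in> T" for e
    using that by (simp add: T_def case_prod_unfold)
  interpret superfrieze_family T m "m + 1" x \<theta> m fst snd
  proof
    fix e assume e: "e \<in> T"
    then obtain R\<^sub>0 R\<^sub>1 where "generic_superfrieze R\<^sub>0 R\<^sub>1 m (fst e) (snd e)" using T by blast
    then interpret e: generic_superfrieze R\<^sub>0 R\<^sub>1 m "fst e" "snd e" .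
    show "\<exists>R\<^sub>0 R\<^sub>1. generic_superfrieze R\<^sub>0 R\<^sub>1 m (fst e) (snd e)" using T e by blast
    have odd: "\<theta> e k \<in> R\<^sub>1" if "k < m + 1" for k
      unfolding \<theta>_def using that by (cases d) (auto intro!: e.phi_odd simp: odd_index_def)
    show "central (x e k)" if "k < m" for k
    proof -
      have "x e k \<in> R\<^sub>0"
        unfolding x_def using that by (cases d) (auto intro!: e.f_even simp: even_index_def)
      then show ?thesis by (simp add: central_def e.even_central)
    qed
    show "invertible (x e k)" if "k < m" for k
      using e that by (simp add: T_def x_def case_prod_unfold)
    show "\<theta> e k * \<theta> e l = - (\<theta> e l * \<theta> e k)" if "k < m + 1" "l < m + 1" for k l
      using that by (intro e.odd_anticommute odd)
    show "\<theta> e k * \<theta> e k = 0" if "k < m + 1" for k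
      using that by (intro e.odd_square odd)
  qed
  obtain j where j: "\<And>l. \<lbrakk>j \<le> l; l < j + int m\<rbrakk> \<Longrightarrow> laurent_unit (\<lambda>e. fst e j l)"
    "\<And>l. \<lbrakk>j \<le> l; l \<le> j + int m\<rbrakk> \<Longrightarrow> laurent (\<lambda>e. U e j l)"
  proof (cases d)
    case (South_East j)
    show thesis
    proof (rule that[of j])
      fix l assume l: "j \<le> l" "l < j + int m"
      show "laurent_unit (\<lambda>e. fst e j l)"
        using laurent_unit_even_variable[of "nat (l - j)"] l by (simp add: x_def South_East)
    next
      fix l assume l: "j \<le> l" "l \<le> j + int m"
      show "laurent (\<lambda>e. U e j l)"
        using laurent_odd_variable[of "nat (l - j)"] l by (simp add: \<theta>_def South_East odd_int_def)
    qed
  next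
    case (North_East j)
    \<comment> \<open>By the glide symmetry, this diagonal read upwards is a South-East diagonal.\<close>
    show thesis
    proof (rule that[of "j - int m - 1"])
      fix l assume l: "j - int m - 1 \<le> l" "l < j - int m - 1 + int m"
      have eq: "\<forall>e\<in>T. x e (nat (j - l - 2)) = fst e (j - int m - 1) l"
        by (rule family_ball, drule generic_superfrieze.f_glide[where i = "l + 2" and j = j])
          (use l in \<open>simp_all add: x_def North_East\<close>)
      show "laurent_unit (\<lambda>e. fst e (j - int m - 1) l)"
        by (rule laurent_unit_cong[OF laurent_unit_even_variable eq]) (use l in simp)
    next
      fix l assume l: "j - int m - 1 \<le> l" "l \<le> j - int m - 1 + int m"
      have eq: "\<forall>e\<in>T. - \<theta> e (nat (j - l - 1)) = U e (j - int m - 1) l"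
        by (rule family_ball, drule generic_superfrieze.w_glide[where i = "l + 1" and j = j])
          (use l in \<open>simp_all add: \<theta>_def North_East odd_half_def\<close>)
      show "laurent (\<lambda>e. U e (j - int m - 1) l)"
        by (rule laurent_cong[OF laurent_uminus[OF laurent_odd_variable] eq]) (use l in simp)
    qed
  qed
  have mem: "(f, \<phi>) \<in> T" if "superfrieze R\<^sub>0 R\<^sub>1 m f \<phi>" "generic m f" "\<forall>n<m. invertible (diag_even f d n)"
    for R\<^sub>0 R\<^sub>1 f \<phi>
    using that by (auto simp: T_def generic_superfrieze_def generic_superfrieze_axioms_def)
  show ?thesis
  proof (intro conjI allI impI)
    fix k l assume "even_index m k l"
    then have "representable (\<lambda>e. fst e k l)"
      by (intro representable_if_laurent laurent_even_entry[OF j])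
    then obtain P where P: "P \<in> super_laurent_polys m (m + 1)"
      "\<forall>e\<in>T. fst e k l = eval_super_laurent P (x e) (\<theta> e)"
      unfolding representable_def by blast
    show "\<exists>P \<in> super_laurent_polys m (m + 1).
             \<forall>(R\<^sub>0 :: 'a::ring_1 set) R\<^sub>1 f \<phi>.
               superfrieze R\<^sub>0 R\<^sub>1 m f \<phi> \<longrightarrow> generic m f \<longrightarrow>
               (\<forall>n<m. invertible (diag_even f d n)) \<longrightarrow>
               f k l = eval_super_laurent P (diag_even f d) (diag_odd \<phi> d)"
      by (rule bexI[OF _ P(1)]) (use P(2) mem in \<open>force simp: x_def \<theta>_def\<close>)
  next
    fix p q assume "odd_index m p q"
    then have "representable (\<lambda>e. snd e p q)"
      by (intro representable_if_laurent laurent_odd_entry[OF j])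
    then obtain P where P: "P \<in> super_laurent_polys m (m + 1)"
      "\<forall>e\<in>T. snd e p q = eval_super_laurent P (x e) (\<theta> e)"
      unfolding representable_def by blast
    show "\<exists>P \<in> super_laurent_polys m (m + 1).
             \<forall>(R\<^sub>0 :: 'a::ring_1 set) R\<^sub>1 f \<phi>.
               superfrieze R\<^sub>0 R\<^sub>1 m f \<phi> \<longrightarrow> generic m f \<longrightarrow>
               (\<forall>n<m. invertible (diag_even f d n)) \<longrightarrow>
               \<phi> p q = eval_super_laurent P (diag_even f d) (diag_odd \<phi> d)"
      by (rule bexI[OF _ P(1)]) (use P(2) mem in \<open>force simp: x_def \<theta>_def\<close>)
  qed
qed

end
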